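(* Suppose that $X$ is an infinite-dimensional Banach space such that, for some $p \in [1,\infty]$, $\ell_p^m$ embeds isometrically into $X$ for each $m \in \mathbb{N}$. Then every finite subset of $\ell_2$ (with the metric inherited from $\ell_2$) admits an isometric embedding into $X$.
   Context: Banach spaces are over $\mathbb{R}$. $\ell_p^m$ is $\mathbb{R}^m$ with the $\ell_p$ norm, and $\ell_2$ is the Hilbert space of real square-summable sequences. An isometric embedding of a metric space into a Banach space is a distance-preserving map, not assumed linear. *)

theory Defs
  imports "HOL-Analysis.Analysis"
begin

text \<open>A distance-preserving map, not assumed linear, from a carrier \<open>M\<close> with distance \<open>d\<close>
  into a metric space given as a type.\<close>

definition isometric_embedding ::
    "'b set \<Rightarrow> ('b \<Rightarrow> 'b \<Rightarrow> real) \<Rightarrow> ('b \<Rightarrow> 'a::metric_space) \<Rightarrow> bool" where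
  "isometric_embedding M d f \<longleftrightarrow> (\<forall>x\<in>M. \<forall>y\<in>M. dist (f x) (f y) = d x y)"

definition embeds_isometrically ::
    "'b set \<Rightarrow> ('b \<Rightarrow> 'b \<Rightarrow> real) \<Rightarrow> 'a::metric_space itself \<Rightarrow> bool" where
  "embeds_isometrically M d X \<longleftrightarrow> (\<exists>f :: 'b \<Rightarrow> 'a. isometric_embedding M d f)"

text \<open>Vectors in \<open>m\<close> real coordinates are functions on \<open>{..<m}\<close>, extended by
  \<^const>\<open>undefined\<close>, so that \<open>m\<close> can be quantified inside a formula.\<close>

definition real_vectors :: "nat \<Rightarrow> (nat \<Rightarrow> real) set" where
  "real_vectors m = {..<m} \<rightarrow>\<^sub>E UNIV"

text \<open>The exponent is meant to satisfy \<open>1 \<le> p \<le> \<infinity>\<close>. Inserting \<open>0\<close> only matters for \<open>m = 0\<close>.\<close>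

definition lp_norm :: "ereal \<Rightarrow> nat \<Rightarrow> (nat \<Rightarrow> real) \<Rightarrow> real" where
  "lp_norm p m x =
    (if p = \<infinity> then Max (insert 0 ((\<lambda>i. \<bar>x i\<bar>) ` {..<m}))
     else (\<Sum>i<m. \<bar>x i\<bar> powr real_of_ereal p) powr (1 / real_of_ereal p))"

definition lp_dist :: "ereal \<Rightarrow> nat \<Rightarrow> (nat \<Rightarrow> real) \<Rightarrow> (nat \<Rightarrow> real) \<Rightarrow> real" where
  "lp_dist p m x y = lp_norm p m (\<lambda>i. x i - y i)"

definition l2 :: "(nat \<Rightarrow> real) set" where
  "l2 = {x. summable (\<lambda>n. (x n)\<^sup>2)}"

definition l2_norm :: "(nat \<Rightarrow> real) \<Rightarrow> real" where
  "l2_norm x = sqrt (\<Sum>n. (x n)\<^sup>2)"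

definition l2_dist :: "(nat \<Rightarrow> real) \<Rightarrow> (nat \<Rightarrow> real) \<Rightarrow> real" where
  "l2_dist x y = l2_norm (\<lambda>n. x n - y n)"

definition infinite_dimensional :: "'a::real_vector itself \<Rightarrow> bool" where
  "infinite_dimensional X \<longleftrightarrow> \<not> (\<exists>B :: 'a set. finite B \<and> span B = UNIV)"

end

theory Submission
  imports Defs "HOL-Probability.Probability"
begin

text \<open>For \<open>p = \<infinity>\<close> use the Frechet embedding. For \<open>p < \<infinity>\<close>, a finite subset of \<open>\<ell>\<^sub>2\<close> lies
  in some Euclidean space, and if \<open>g\<close> is a standard Gaussian vector there, then
  \<open>E \<bar>\<langle>v, g\<rangle>\<bar>\<^sup>p\<close> is a constant multiple of \<open>\<parallel>v\<parallel>\<^sup>p\<close>. So on the finite set the \<open>p\<close>-th power of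
  the distance is an average of the kernels \<open>\<bar>\<langle>s, g\<rangle> - \<langle>t, g\<rangle>\<bar>\<^sup>p\<close>, and the mean of a random
  vector with finitely many coordinates is a finite convex combination of its values. Absorbing
  the weights into the points turns such a combination into the \<open>p\<close>-th power of an
  \<open>\<ell>\<^sub>p\<^sup>m\<close> distance.\<close>

section \<open>Means as finite combinations of values\<close>

text \<open>Both summands of the pairing \<open>H\<close> in the next proof have this product form,
  so its mean is computed from the means over the two factors.\<close>

lemma (in pair_sigma_finite)
  fixes f g :: "_ \<Rightarrow> real"
  assumes f: "integrable M1 f" and g: "integrable M2 g"
  shows integrable_fst_mult_snd: "integrable (M1 \<Otimes>\<^sub>M M2) (\<lambda>z. f (fst z) * g (snd z))"
    and integral_fst_mult_snd:
      "(\<integral>z. f (fst z) * g (snd z) \<partial>(M1 \<Otimes>\<^sub>M M2)) = (\<integral>x. f x \<partial>M1) * (\<integral>y. g y \<partial>M2)"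
proof -
  have [measurable]: "f \<in> borel_measurable M1" "g \<in> borel_measurable M2"
    using f g by auto
  show int: "integrable (M1 \<Otimes>\<^sub>M M2) (\<lambda>z. f (fst z) * g (snd z))"
  proof (rule Fubini_integrable)
    show "(\<lambda>z. f (fst z) * g (snd z)) \<in> borel_measurable (M1 \<Otimes>\<^sub>M M2)"
      by measurable
    show "integrable M1 (\<lambda>x. \<integral>y. norm (f (fst (x, y)) * g (snd (x, y))) \<partial>M2)"
      using f by (simp add: abs_mult)
    show "AE x in M1. integrable M2 (\<lambda>y. f (fst (x, y)) * g (snd (x, y)))"
      using g by simp
  qed
  show "(\<integral>z. f (fst z) * g (snd z) \<partial>(M1 \<Otimes>\<^sub>M M2)) = (\<integral>x. f x \<partial>M1) * (\<integral>y. g y \<partial>M2)"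
    using integral_fst[of "\<lambda>x y. f x * g y"] int by (simp add: case_prod_unfold)
qed

text \<open>A form of the Richter--Tchakaloff theorem. Coordinates are eliminated one at a time, so no
  separation theorem, and hence no Euclidean type of the right dimension, is needed. The cone \<open>K\<close>
  need not contain \<open>0\<close>, so the conclusion is not trivial.\<close>

lemma cone_meets_kernel_of_mean_zero:
  fixes K :: "('i \<Rightarrow> real) set" and N :: "('i \<Rightarrow> real) measure"
  assumes "finite I"
    and "\<And>x y. x \<in> K \<Longrightarrow> y \<in> K \<Longrightarrow> (\<lambda>i. x i + y i) \<in> K"
    and "\<And>c x. x \<in> K \<Longrightarrow> 0 < c \<Longrightarrow> (\<lambda>i. c * x i) \<in> K"
    and "finite_measure N" "emeasure N (space N) \<noteq> 0" "space N \<subseteq> K"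
    and "\<And>i. (\<lambda>x. x i) \<in> borel_measurable N"
    and "\<And>i. i \<in> I \<Longrightarrow> integrable N (\<lambda>x. x i)"
    and "\<And>i. i \<in> I \<Longrightarrow> (\<integral>x. x i \<partial>N) = 0"
  shows "\<exists>k\<in>K. \<forall>i\<in>I. k i = 0"
  using assms
proof (induction I arbitrary: K N rule: finite_induct)
  case empty
  \<comment> \<open>Nonzero mass supplies a point of the space, and with no coordinates left any
    point of \<open>K\<close> will do.\<close>
  then have "space N \<noteq> {}"
    by (metis emeasure_empty)
  then show ?case
    using empty.prems by auto
next
  case (insert j I K N)
  note add = insert.prems(1) and scale = insert.prems(2)
  note NK = insert.prems(5)
  note meas [measurable] = insert.prems(6)
  interpret finite_measure N by fact
  define K' where "K' = {k \<in> K. k j = 0}"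
  have K'_add: "(\<lambda>i. x i + y i) \<in> K'" if "x \<in> K'" "y \<in> K'" for x y
    using that add by (auto simp: K'_def)
  have K'_scale: "(\<lambda>i. c * x i) \<in> K'" if "x \<in> K'" "0 < c" for c x
    using that scale by (auto simp: K'_def)
  have intj: "integrable N (\<lambda>x. x j)" "(\<integral>x. x j \<partial>N) = 0"
    using insert.prems by auto
  \<comment> \<open>\<open>K'\<close> is again closed under sums and positive multiples. To apply
    the induction hypothesis, it remains to construct a nonzero finite measure living on
    \<open>K'\<close> whose means over the coordinates in \<open>I\<close> vanish.\<close>
  have "\<exists>k\<in>K'. \<forall>i\<in>I. k i = 0"
  proof (cases "AE x in N. x j = 0")
    case True
    \<comment> \<open>Almost all of \<open>N\<close> already lives on the hyperplane, so restricting
      to it changes neither the mass nor the means.\<close>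
    define Z where "Z = {x \<in> space N. x j = 0}"
    have Z [measurable]: "Z \<in> sets N"
      unfolding Z_def by measurable
    have AEZ: "AE x in N. x \<in> Z"
      using True by (auto simp: Z_def)
    show ?thesis
    proof (rule insert.IH[OF K'_add K'_scale])
      show "finite_measure (restrict_space N Z)"
        using finite_measure_restrict_space[OF _ Z] finite_measure_axioms by blast
      have "emeasure N Z = emeasure N (space N)"
        using AEZ by (intro emeasure_eq_AE) auto
      then show "emeasure (restrict_space N Z) (space (restrict_space N Z)) \<noteq> 0"
        using insert.prems(4) Z by (simp add: emeasure_restrict_space)
      show "space (restrict_space N Z) \<subseteq> K'"
        using NK Z by (auto simp: K'_def Z_def)
      show "(\<lambda>x. x i) \<in> borel_measurable (restrict_space N Z)" for i
        by (rule measurable_restrict_space1) measurable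
      fix i assume i: "i \<in> I"
      then have "integrable N (\<lambda>x. x i)" "(\<integral>x. x i \<partial>N) = 0"
        using insert.prems by auto
      then show "integrable (restrict_space N Z) (\<lambda>x. x i)"
        using Z integrable_mult_indicator[OF Z, of "\<lambda>x. x i"] by (simp add: integrable_restrict_space)
      have "(\<integral>x. x i \<partial>restrict_space N Z) = (\<integral>x. x i \<partial>N)"
        using Z AEZ by (subst integral_restrict_space) (auto intro!: integral_cong_AE)
      then show "(\<integral>x. x i \<partial>restrict_space N Z) = 0"
        using \<open>(\<integral>x. x i \<partial>N) = 0\<close> by simp
    qed
  next
    case False
    \<comment> \<open>Points with \<open>x j = 0\<close> go to \<open>A\<close>, so that
      \<open>- y j\<close> is strictly positive on \<open>B\<close> and may serve as a scaling
      factor in \<open>K\<close>.\<close>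
    define A where "A = {x \<in> space N. 0 \<le> x j}"
    define B where "B = {x \<in> space N. x j < 0}"
    have A [measurable]: "A \<in> sets N"
      unfolding A_def by measurable
    have B [measurable]: "B \<in> sets N"
      unfolding B_def by measurable
    define NA where "NA = restrict_space N A"
    define NB where "NB = restrict_space N B"
    have spA: "space NA = A" and spB: "space NB = B"
      using A B by (auto simp: NA_def NB_def)
    have finA: "finite_measure NA" and finB: "finite_measure NB"
      using finite_measure_restrict_space[OF finite_measure_axioms] A B by (auto simp: NA_def NB_def)
    interpret NA: finite_measure NA by fact
    interpret NB: finite_measure NB by fact
    interpret P: pair_sigma_finite NA NB ..
    have measA [measurable]: "(\<lambda>x. x i) \<in> borel_measurable NA"
      and measB [measurable]: "(\<lambda>x. x i) \<in> borel_measurable NB" for i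
      unfolding NA_def NB_def by (rule measurable_restrict_space1[OF meas])+
    have int: "integrable NA (\<lambda>x. x i)" "integrable NB (\<lambda>x. x i)"
        "(\<integral>x. x i \<partial>NA) + (\<integral>x. x i \<partial>NB) = 0" if "i \<in> insert j I" for i
    proof -
      have i: "integrable N (\<lambda>x. x i)" "(\<integral>x. x i \<partial>N) = 0"
        using insert.prems that by auto
      have iA: "integrable N (\<lambda>x. indicator A x *\<^sub>R x i)"
        and iB: "integrable N (\<lambda>x. indicator B x *\<^sub>R x i)"
        using integrable_mult_indicator[OF _ i(1)] A B by blast+
      then show "integrable NA (\<lambda>x. x i)" "integrable NB (\<lambda>x. x i)"
        using A B by (auto simp: NA_def NB_def integrable_restrict_space)
      have "(\<integral>x. x i \<partial>NA) + (\<integral>x. x i \<partial>NB)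
          = (\<integral>x. indicator A x *\<^sub>R x i + indicator B x *\<^sub>R x i \<partial>N)"
        using iA iB A B by (simp add: NA_def NB_def integral_restrict_space)
      also have "\<dots> = (\<integral>x. x i \<partial>N)"
        by (intro Bochner_Integration.integral_cong) (auto simp: A_def B_def indicator_def)
      finally show "(\<integral>x. x i \<partial>NA) + (\<integral>x. x i \<partial>NB) = 0"
        using i by simp
    qed
    define m where "m = (\<integral>x. x j \<partial>NA)"
    have mB: "(\<integral>x. x j \<partial>NB) = - m"
      using int(3)[of j] by (simp add: m_def)
    \<comment> \<open>If \<open>A\<close> or \<open>B\<close> were null, the \<open>j\<close>-th
      coordinate would have constant sign almost everywhere and mean zero. It would then vanish
      almost everywhere, contrary to the case assumption.\<close>
    have nullB: "emeasure N B \<noteq> 0"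
    proof
      assume "emeasure N B = 0"
      then have AEB: "AE x in N. 0 \<le> x j"
        using B by (intro AE_I[of _ _ B]) (auto simp: B_def)
      have "AE x in N. x j = 0"
        using integral_nonneg_eq_0_iff_AE[OF intj(1) AEB] intj(2) by simp
      with False show False by simp
    qed
    have nullA: "emeasure N A \<noteq> 0"
    proof
      assume "emeasure N A = 0"
      then have AEA: "AE x in N. 0 \<le> - x j"
        using A by (intro AE_I[of _ _ A]) (auto simp: A_def)
      have "AE x in N. - x j = 0"
        using integral_nonneg_eq_0_iff_AE[OF _ AEA] intj by simp
      with False show False by simp
    qed
    \<comment> \<open>Pairing a point of \<open>A\<close> with one of \<open>B\<close>, weighted so that the \<open>j\<close>-th coordinates cancel,
      maps into \<open>K'\<close>; integrating over \<open>A \<times> B\<close> gives \<open>m\<close> times the original mean.\<close>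
    define H where "H = (\<lambda>z::('i\<Rightarrow>real)\<times>('i\<Rightarrow>real). \<lambda>i. fst z i * - snd z j + fst z j * snd z i)"
    have HK: "H (x, y) \<in> K'" if "x \<in> A" "y \<in> B" for x y
    proof -
      have xy: "x \<in> K" "y \<in> K" "0 \<le> x j" "0 < - y j"
        using that NK by (auto simp: A_def B_def)
      have 1: "(\<lambda>i. - y j * x i) \<in> K"
        using scale xy by blast
      have "H (x, y) \<in> K"
      \<comment> \<open>\<open>K\<close> is closed under strictly positive multiples only; for
        \<open>x j = 0\<close> the second summand of \<open>H\<close> is dropped.\<close>
      proof (cases "x j = 0")
        case True
        then show ?thesis using 1 by (simp add: H_def mult.commute)
      next
        case False
        then have "(\<lambda>i. x j * y i) \<in> K"
          using scale xy by simp
        from add[OF 1 this] show ?thesis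
          by (simp add: H_def mult.commute)
      qed
      then show ?thesis by (simp add: K'_def H_def)
    qed
    \<comment> \<open>The trace of the product sigma-algebra has \<open>K'\<close> as its whole
      space, whether or not \<open>K'\<close> is measurable, so the image measure under
      \<open>H\<close> lives on \<open>K'\<close>.\<close>
    define R where "R = restrict_space (PiM (UNIV::'i set) (\<lambda>_. borel::real measure)) K'"
    have Hmeas [measurable]: "H \<in> measurable (NA \<Otimes>\<^sub>M NB) R"
      unfolding R_def
    proof (rule measurable_restrict_space2)
      show "H \<in> space (NA \<Otimes>\<^sub>M NB) \<rightarrow> K'"
        using HK by (auto simp: space_pair_measure spA spB)
      show "H \<in> measurable (NA \<Otimes>\<^sub>M NB) (PiM UNIV (\<lambda>_. borel))"
      proof (rule measurable_PiM_single')
        show "(\<lambda>z. H z i) \<in> borel_measurable (NA \<Otimes>\<^sub>M NB)" for i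
          unfolding H_def by measurable
      qed auto
    qed
    have Rmeas [measurable]: "(\<lambda>x. x i) \<in> borel_measurable R" for i
      unfolding R_def by (rule measurable_restrict_space1) (rule measurable_component_singleton, simp)
    show ?thesis
    proof (rule insert.IH[OF K'_add K'_scale])
      have finP: "finite_measure (NA \<Otimes>\<^sub>M NB)"
        by (rule finite_measure_pair_measure) fact+
      then show "finite_measure (distr (NA \<Otimes>\<^sub>M NB) R H)"
        by (rule finite_measure.finite_measure_distr) measurable
      have "emeasure (NA \<Otimes>\<^sub>M NB) (A \<times> B) = emeasure NA A * emeasure NB B"
        using sets.top[of NA] sets.top[of NB]
        by (intro NB.emeasure_pair_measure_Times) (simp_all add: spA spB)
      also have "\<dots> \<noteq> 0"
        using nullA nullB A B by (simp add: NA_def NB_def emeasure_restrict_space)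
      finally show "emeasure (distr (NA \<Otimes>\<^sub>M NB) R H) (space (distr (NA \<Otimes>\<^sub>M NB) R H)) \<noteq> 0"
        using measurable_space[OF Hmeas]
        by (simp add: emeasure_distr space_pair_measure spA spB Int_absorb1 subset_iff)
      show "space (distr (NA \<Otimes>\<^sub>M NB) R H) \<subseteq> K'"
        by (auto simp: R_def space_restrict_space)
      show "(\<lambda>x. x i) \<in> borel_measurable (distr (NA \<Otimes>\<^sub>M NB) R H)" for i
        by simp
      fix i assume i: "i \<in> I"
      note ints = int[of i] int[of j]
      have 1: "integrable (NA \<Otimes>\<^sub>M NB) (\<lambda>z. fst z i * - snd z j)"
        "(\<integral>z. fst z i * - snd z j \<partial>(NA \<Otimes>\<^sub>M NB)) = (\<integral>x. x i \<partial>NA) * m"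
        using P.integrable_fst_mult_snd[of "\<lambda>x. x i" "\<lambda>x. - x j"]
          P.integral_fst_mult_snd[of "\<lambda>x. x i" "\<lambda>x. - x j"] ints i mB by simp_all
      have 2: "integrable (NA \<Otimes>\<^sub>M NB) (\<lambda>z. fst z j * snd z i)"
        "(\<integral>z. fst z j * snd z i \<partial>(NA \<Otimes>\<^sub>M NB)) = m * (\<integral>x. x i \<partial>NB)"
        using P.integrable_fst_mult_snd[of "\<lambda>x. x j" "\<lambda>x. x i"]
          P.integral_fst_mult_snd[of "\<lambda>x. x j" "\<lambda>x. x i"] ints i m_def by simp_all
      show "integrable (distr (NA \<Otimes>\<^sub>M NB) R H) (\<lambda>x. x i)"
        using Bochner_Integration.integrable_add[OF 1(1) 2(1)]
        by (subst integrable_distr_eq) (simp_all add: H_def[symmetric], simp_all add: H_def)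
      have "(\<integral>x. x i \<partial>distr (NA \<Otimes>\<^sub>M NB) R H) = (\<integral>z. H z i \<partial>(NA \<Otimes>\<^sub>M NB))"
        by (rule integral_distr) measurable
      also have "\<dots> = (\<integral>x. x i \<partial>NA) * m + m * (\<integral>x. x i \<partial>NB)"
        unfolding H_def Bochner_Integration.integral_add[OF 1(1) 2(1)] 1(2) 2(2) ..
      also have "\<dots> = m * ((\<integral>x. x i \<partial>NA) + (\<integral>x. x i \<partial>NB))"
        by (simp add: algebra_simps)
      finally show "(\<integral>x. x i \<partial>distr (NA \<Otimes>\<^sub>M NB) R H) = 0"
        using ints(3) i by simp
    qed
  qed
  then show ?case
    by (auto simp: K'_def)
qed

section \<open>Absolute moments of Gaussian vectors\<close>

definition iid_normal :: "nat \<Rightarrow> (nat \<Rightarrow> real) measure" where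
  "iid_normal n = PiM {..<n} (\<lambda>_. density lborel (\<lambda>x. ennreal (std_normal_density x)))"

lemma prob_space_iid_normal: "prob_space (iid_normal n)"
  unfolding iid_normal_def by (intro prob_space_PiM prob_space_normal_density) simp

lemma measurable_iid_normal [measurable]:
  "i < n \<Longrightarrow> (\<lambda>x. x i) \<in> borel_measurable (iid_normal n)"
  unfolding iid_normal_def by measurable

lemma distributed_iid_normal:
  assumes "i < n"
  shows "distributed (iid_normal n) lborel (\<lambda>x. x i) std_normal_density"
proof -
  have "distr (iid_normal n) lborel (\<lambda>x. x i)
      = distr (iid_normal n) (density lborel (\<lambda>x. ennreal (std_normal_density x))) (\<lambda>x. x i)"
    by (rule distr_cong) auto
  also have "\<dots> = density lborel (\<lambda>x. ennreal (std_normal_density x))"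
    unfolding iid_normal_def
    by (rule distr_PiM_component) (use assms prob_space_normal_density[of 1 0] in auto)
  finally show ?thesis
    using assms by (simp add: distributed_def)
qed

text \<open>The joint law of the coordinate maps is the product measure itself, hence the product of
  its marginals; scaling each coordinate preserves independence.\<close>

lemma indep_vars_iid_normal:
  assumes "I \<subseteq> {..<n}" "I \<noteq> {}"
  shows "prob_space.indep_vars (iid_normal n) (\<lambda>_. borel) (\<lambda>i x. a i * x i) I"
proof -
  interpret prob_space "iid_normal n" by (rule prob_space_iid_normal)
  have "indep_vars (\<lambda>_. borel) (\<lambda>i x. x i) {..<n}"
  proof -
    have "distr (iid_normal n) (PiM {..<n} (\<lambda>_. borel)) (\<lambda>x. \<lambda>i\<in>{..<n}. x i) = distr (iid_normal n) (iid_normal n) (\<lambda>x. x)"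
    proof (rule distr_cong)
      show "sets (PiM {..<n} (\<lambda>_. borel)) = sets (iid_normal n)"
        unfolding iid_normal_def by (intro sets_PiM_cong) auto
      fix x assume "x \<in> space (iid_normal n)"
      then show "(\<lambda>i\<in>{..<n}. x i) = x"
        by (auto simp: iid_normal_def space_PiM PiE_iff extensional_restrict)
    qed simp
    also have "\<dots> = (\<Pi>\<^sub>M i\<in>{..<n}. distr (iid_normal n) borel (\<lambda>x. x i))"
    proof -
      have "distr (iid_normal n) borel (\<lambda>x. x i) = density lborel (\<lambda>x. ennreal (std_normal_density x))" if "i < n" for i
      proof -
        have "distr (iid_normal n) borel (\<lambda>x. x i) = distr (iid_normal n) lborel (\<lambda>x. x i)"
          by (rule distr_cong) auto
        then show ?thesis
          using distributed_iid_normal[OF that] by (simp add: distributed_def)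
      qed
      then show ?thesis
        unfolding distr_id iid_normal_def[of n, symmetric]
        by (subst iid_normal_def) (intro PiM_cong, auto)
    qed
    finally show ?thesis
      using assms by (subst indep_vars_iff_distr_eq_PiM') auto
  qed
  then have "indep_vars (\<lambda>_. borel) (\<lambda>i x. x i) I"
    using assms(1) by (rule indep_vars_subset)
  then show ?thesis
    using indep_vars_compose2[where Y="\<lambda>i x. a i * x" and N="\<lambda>_. borel" and X="\<lambda>i x. x i"] by simp
qed

text \<open>For a natural number k above p, the power is dominated by 1 plus the k-th absolute
  power, whose Gaussian integral is finite.\<close>

lemma integrable_std_normal_powr:
  assumes "0 \<le> p"
  shows "integrable lborel (\<lambda>x. std_normal_density x * \<bar>x\<bar> powr p)"
proof -
  obtain k :: nat where k: "p \<le> real k"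
    using real_arch_simple by blast
  show ?thesis
  proof (rule Bochner_Integration.integrable_bound)
    show "integrable lborel (\<lambda>x. std_normal_density x * \<bar>x\<bar> ^ 0 + std_normal_density x * \<bar>x\<bar> ^ k)"
      by (intro Bochner_Integration.integrable_add integrable_std_normal_moment_abs)
    have "\<bar>x\<bar> powr p \<le> 1 + \<bar>x\<bar> ^ k" for x :: real
    proof (cases "\<bar>x\<bar> \<le> 1")
      case True
      then have "\<bar>x\<bar> powr p \<le> 1"
        using assms powr_mono2[of p "\<bar>x\<bar>" 1] by simp
      then show ?thesis by (smt (verit) zero_le_power abs_ge_zero)
    next
      case False
      then have "\<bar>x\<bar> powr p \<le> \<bar>x\<bar> powr real k"
        using k by (intro powr_mono) auto
      then show ?thesis using False by (simp add: powr_realpow)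
    qed
    then have "std_normal_density x * \<bar>x\<bar> powr p
        \<le> std_normal_density x * \<bar>x\<bar> ^ 0 + std_normal_density x * \<bar>x\<bar> ^ k" for x
      using mult_left_mono[of "\<bar>x\<bar> powr p" "1 + \<bar>x\<bar> ^ k" "std_normal_density x"]
      by (simp add: distrib_left)
    then show "AE x in lborel. norm (std_normal_density x * \<bar>x\<bar> powr p)
        \<le> norm (std_normal_density x * \<bar>x\<bar> ^ 0 + std_normal_density x * \<bar>x\<bar> ^ k)"
      by simp
  qed simp
qed

definition normal_abs_moment :: "real \<Rightarrow> real" where
  "normal_abs_moment p = (\<integral>x. std_normal_density x * \<bar>x\<bar> powr p \<partial>lborel)"

text \<open>The integrand vanishes only at the origin, a Lebesgue null set. Positivity permits
  division by this constant later.\<close>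

lemma normal_abs_moment_pos:
  assumes "0 \<le> p"
  shows "0 < normal_abs_moment p"
proof -
  have nn: "AE x in lborel. 0 \<le> std_normal_density x * \<bar>x\<bar> powr p"
    by simp
  have "normal_abs_moment p \<noteq> 0"
  proof
    assume "normal_abs_moment p = 0"
    then have "AE x in lborel. std_normal_density x * \<bar>x\<bar> powr p = 0"
      using integral_nonneg_eq_0_iff_AE[OF integrable_std_normal_powr[OF assms] nn]
      by (simp add: normal_abs_moment_def)
    then have "AE x::real in lborel. x = 0"
      by (rule AE_mp) (auto intro!: AE_I2 simp: less_imp_neq[OF normal_density_pos, symmetric])
    moreover have "AE x::real in lborel. x \<noteq> 0"
      by (rule AE_lborel_singleton)
    ultimately have "AE x::real in lborel. False"
      by eventually_elim simp
    then show False
      by (simp add: eventually_False ae_filter_eq_bot_iff)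
  qed
  moreover have "0 \<le> normal_abs_moment p"
    unfolding normal_abs_moment_def by (rule integral_nonneg_AE[OF nn])
  ultimately show ?thesis by simp
qed

text \<open>A combination of independent standard normals with coefficient vector \<open>a\<close>
  is centred normal with standard deviation the Euclidean norm of \<open>a\<close>. Dividing by that
  norm reduces to one standard normal variable, and the norm comes out as its p-th power.\<close>

lemma
  assumes p: "0 < p"
  shows integrable_iid_normal_powr:
      "integrable (iid_normal n) (\<lambda>x. \<bar>\<Sum>i<n. a i * x i\<bar> powr p)"
    and integral_iid_normal_powr:
      "(\<integral>x. \<bar>\<Sum>i<n. a i * x i\<bar> powr p \<partial>iid_normal n)
        = normal_abs_moment p * sqrt (\<Sum>i<n. (a i)\<^sup>2) powr p"
proof -
  interpret prob_space "iid_normal n" by (rule prob_space_iid_normal)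
  \<comment> \<open>Zero coefficients are discarded because the rule for sums of independent normals
    wants positive standard deviations.\<close>
  define I where "I = {i. i < n \<and> a i \<noteq> 0}"
  define s where "s = sqrt (\<Sum>i<n. (a i)\<^sup>2)"
  have sumI: "(\<Sum>i<n. a i * x i) = (\<Sum>i\<in>I. a i * x i)" for x
    by (rule sum.mono_neutral_right) (auto simp: I_def)
  have s_I: "s = sqrt (\<Sum>i\<in>I. \<bar>a i\<bar>\<^sup>2)"
    unfolding s_def by (intro arg_cong[where f=sqrt] sum.mono_neutral_cong_right) (auto simp: I_def)
  have "integrable (iid_normal n) (\<lambda>x. \<bar>\<Sum>i<n. a i * x i\<bar> powr p) \<and>
    (\<integral>x. \<bar>\<Sum>i<n. a i * x i\<bar> powr p \<partial>iid_normal n) = normal_abs_moment p * s powr p"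
  proof (cases "I = {}")
    case True
    then show ?thesis
      by (simp add: sumI s_I)
  next
    case False
    have fin: "finite I" by (simp add: I_def)
    have s: "0 < s"
      unfolding s_I using False fin by (intro real_sqrt_gt_zero sum_pos) (auto simp: I_def)
    have "distributed (iid_normal n) lborel (\<lambda>x. \<Sum>i\<in>I. a i * x i)
        (normal_density (\<Sum>i\<in>I. 0) (sqrt (\<Sum>i\<in>I. \<bar>a i\<bar>\<^sup>2)))"
    proof (rule sum_indep_normal[OF fin False indep_vars_iid_normal])
      fix i assume i: "i \<in> I"
      then show "distributed (iid_normal n) lborel (\<lambda>x. a i * x i) (normal_density 0 \<bar>a i\<bar>)"
        using normal_density_affine[OF distributed_iid_normal, of i "a i" 0] by (simp add: I_def)
    qed (use False in \<open>auto simp: I_def\<close>)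
    then have "distributed (iid_normal n) lborel (\<lambda>x. \<Sum>i<n. a i * x i) (normal_density 0 s)"
      by (simp add: sumI s_I)
    then have D: "distributed (iid_normal n) lborel (\<lambda>x. (\<Sum>i<n. a i * x i) / s) std_normal_density"
      using normal_standard_normal_convert[OF s, of "\<lambda>x. \<Sum>i<n. a i * x i" 0] by simp
    have eq: "\<bar>\<Sum>i<n. a i * x i\<bar> powr p = s powr p * \<bar>(\<Sum>i<n. a i * x i) / s\<bar> powr p" for x
      using s by (simp add: powr_mult[symmetric])
    have "integrable (iid_normal n) (\<lambda>x. \<bar>(\<Sum>i<n. a i * x i) / s\<bar> powr p)"
      using distributed_integrable[OF D, of "\<lambda>y. \<bar>y\<bar> powr p"] integrable_std_normal_powr[of p] p
      by simp
    moreover have "(\<integral>x. \<bar>(\<Sum>i<n. a i * x i) / s\<bar> powr p \<partial>iid_normal n) = normal_abs_moment p"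
      using distributed_integral[OF D, of "\<lambda>y. \<bar>y\<bar> powr p"] by (simp add: normal_abs_moment_def)
    ultimately show ?thesis
      unfolding eq by simp
  qed
  then show "integrable (iid_normal n) (\<lambda>x. \<bar>\<Sum>i<n. a i * x i\<bar> powr p)"
    "(\<integral>x. \<bar>\<Sum>i<n. a i * x i\<bar> powr p \<partial>iid_normal n)
      = normal_abs_moment p * sqrt (\<Sum>i<n. (a i)\<^sup>2) powr p"
    by (simp_all add: s_def)
qed

section \<open>Finite subsets of \<open>\<ell>\<^sub>2\<close>\<close>

text \<open>On the i-th unit vector plus t times the n-th, the quadratic form is affine in t with
  slope \<open>2 * G i n\<close>, so a nonzero slope would make it negative somewhere.\<close>

lemma pos_semidef_zero_row:
  fixes G :: "nat \<Rightarrow> nat \<Rightarrow> real"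
  assumes sym: "\<And>i j. G i j = G j i"
    and psd: "\<And>a. 0 \<le> (\<Sum>i<Suc n. \<Sum>j<Suc n. a i * a j * G i j)"
    and zero: "G n n = 0" and "i < n"
  shows "G i n = 0"
proof (rule ccontr)
  assume nz: "G i n \<noteq> 0"
  have sum2: "(\<Sum>k<Suc n. f k) = f i + f n" if "\<And>k. k < n \<Longrightarrow> k \<noteq> i \<Longrightarrow> f k = 0" for f :: "nat \<Rightarrow> real"
    using that \<open>i < n\<close> by (simp add: sum.remove[of "{..<n}" i])
  \<comment> \<open>Solves \<open>G i i + 2 * t * G i n = -1\<close>.\<close>
  define t where "t = - (G i i + 1) / (2 * G i n)"
  define a where "a k = (if k = i then 1 else if k = n then t else 0)" for k
  have "(\<Sum>k<Suc n. \<Sum>l<Suc n. a k * a l * G k l) = G i i + 2 * t * G i n"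
    by (subst sum2; (subst sum2)?; (subst sum2)?)
       (use \<open>i < n\<close> zero sym[of n i] in \<open>auto simp: a_def\<close>)
  also have "\<dots> = -1"
  proof -
    have "2 * t * G i n = - (G i i + 1)"
      using nz by (simp add: t_def)
    then show ?thesis by simp
  qed
  finally show False
    using psd[of a] by simp
qed

text \<open>Subtracting the rank-one matrix \<open>b i * b j\<close> clears the last row and column;
  the remaining block is still positive semidefinite and is factored by induction.\<close>

lemma cholesky_decomposition:
  fixes G :: "nat \<Rightarrow> nat \<Rightarrow> real"
  assumes "\<And>i j. G i j = G j i"
    and "\<And>a. 0 \<le> (\<Sum>i<n. \<Sum>j<n. a i * a j * G i j)"
  shows "\<exists>c. \<forall>i<n. \<forall>j<n. G i j = (\<Sum>k<n. c i k * c j k)"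
  using assms
proof (induction n arbitrary: G)
  case (Suc n)
  note sym = Suc.prems(1)
  define b where "b i = G i n / sqrt (G n n)" for i
  \<comment> \<open>\<open>G'\<close> is the Schur complement; if \<open>G n n = 0\<close>, then \<open>b = 0\<close> because \<open>x / 0 = 0\<close>.\<close>
  define G' where "G' i j = G i j - b i * b j" for i j
  have Gnn: "0 \<le> G n n"
  proof -
    have "(\<Sum>i<Suc n. \<Sum>j<Suc n. (if i = n then 1 else 0) * (if j = n then 1 else 0) * G i j) = G n n"
      by simp
    then show ?thesis
      using Suc.prems(2)[of "\<lambda>i. if i = n then 1 else 0"] by simp
  qed
  have row: "G i n = b i * b n" if "i < Suc n" for i
  proof (cases "G n n = 0")
    case True
    then have "G i n = 0"
      using pos_semidef_zero_row[OF Suc.prems True] that by (auto simp: less_Suc_eq)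
    with True show ?thesis by (simp add: b_def)
  next
    case False
    with Gnn show ?thesis by (simp add: b_def real_div_sqrt)
  qed
  have psd': "0 \<le> (\<Sum>i<n. \<Sum>j<n. a i * a j * G' i j)" for a
  proof -
    define s where "s = (\<Sum>i<n. a i * b i)"
    \<comment> \<open>Completing the square: the form of \<open>G\<close> at \<open>a'\<close> is
      the form of \<open>G'\<close> at \<open>a\<close> plus \<open>(s + t * b n)\<close> squared,
      and this \<open>t\<close> kills the square. If \<open>b n = 0\<close>, all of \<open>b\<close>
      is zero and so is \<open>s\<close>.\<close>
    define t where "t = (if b n = 0 then 0 else - s / b n)"
    define a' where "a' = a(n := t)"
    have b0: "G n n = b n * b n" using row by simp
    have Gin: "G i n = b i * b n" "G n i = b i * b n" if "i < n" for i
      using row[of i] sym[of n i] that by auto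
    have "(\<Sum>i<Suc n. \<Sum>j<Suc n. a' i * a' j * G i j)
        = (\<Sum>i<n. \<Sum>j<n. a i * a j * G i j) + 2 * (\<Sum>i<n. a i * t * (b i * b n)) + t * t * (b n * b n)"
      by (simp add: a'_def sum.distrib Gin b0 algebra_simps)
    also have "(\<Sum>i<n. a i * t * (b i * b n)) = t * b n * s"
      by (simp add: s_def sum_distrib_left algebra_simps)
    also have "(\<Sum>i<n. \<Sum>j<n. a i * a j * G i j) = (\<Sum>i<n. \<Sum>j<n. a i * a j * G' i j) + s * s"
    proof -
      have "a i * a j * G i j = a i * a j * G' i j + (a i * b i) * (a j * b j)" for i j
        by (simp add: G'_def algebra_simps)
      then show ?thesis
        by (simp add: s_def sum_product sum.distrib)
    qed
    finally have "0 \<le> (\<Sum>i<n. \<Sum>j<n. a i * a j * G' i j) + (s + t * b n)\<^sup>2"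
      using Suc.prems(2)[of a'] by (simp add: power2_eq_square algebra_simps)
    moreover have "s + t * b n = 0"
    proof (cases "b n = 0")
      case True
      then have "G n n = 0"
        using b0 by simp
      then have "b i = 0" for i
        by (simp add: b_def)
      then show ?thesis by (simp add: s_def)
    qed (simp add: t_def)
    ultimately show ?thesis by simp
  qed
  have "G' i j = G' j i" for i j
    by (simp add: G'_def sym[of i j])
  from Suc.IH[OF this psd'] obtain c where
    c: "\<And>i j. i < n \<Longrightarrow> j < n \<Longrightarrow> G' i j = (\<Sum>k<n. c i k * c j k)"
    by blast
  \<comment> \<open>The new last column is \<open>b\<close> and the new row is zero outside it, so
    products with that row give \<open>b i * b n\<close>.\<close>
  define c' where "c' i k = (if k = n then b i else if i = n then 0 else c i k)" for i k
  have "G i j = (\<Sum>k<Suc n. c' i k * c' j k)" if "i < Suc n" "j < Suc n" for i j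
  proof (cases "i = n \<or> j = n")
    case True
    then show ?thesis
      using row[of i] row[of j] sym[of i j] that by (auto simp: c'_def)
  next
    case False
    then show ?thesis
      using c[of i j] that by (simp add: c'_def G'_def)
  qed
  then show ?case by blast
qed simp

section \<open>Euclidean realization through Gram matrices\<close>

lemma summable_mult_l2:
  assumes "x \<in> l2" "y \<in> l2"
  shows "summable (\<lambda>n. x n * y n)"
proof (rule summable_comparison_test')
  show "summable (\<lambda>n. (x n)\<^sup>2 + (y n)\<^sup>2)"
    using assms by (auto simp: l2_def intro: summable_add)
  have "2 * \<bar>x n * y n\<bar> \<le> (x n)\<^sup>2 + (y n)\<^sup>2" for n
    using sum_squares_bound[of "\<bar>x n\<bar>" "\<bar>y n\<bar>"] by (simp add: abs_mult)
  then show "norm (x n * y n) \<le> (x n)\<^sup>2 + (y n)\<^sup>2" if "0 \<le> n" for n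
    by (smt (verit) abs_ge_zero real_norm_def)
qed

text \<open>Distances depend only on the Gram matrix, so the rows of a Cholesky factor of that
  matrix have the same mutual distances as the given points.\<close>

lemma finite_l2_euclidean:
  assumes "finite S" "S \<subseteq> l2"
  shows "\<exists>(n::nat) c. \<forall>s\<in>S. \<forall>t\<in>S. l2_dist s t = sqrt (\<Sum>k<n. (c s k - c t k)\<^sup>2)"
proof -
  define n where "n = card S"
  obtain h where h: "bij_betw h S {0..<n}"
    using ex_bij_betw_finite_nat[OF assms(1)] n_def by blast
  define u where "u = inv_into S h"
  have u: "u i \<in> l2" if "i < n" for i
    using bij_betw_inv_into[OF h] that assms(2) by (auto simp: u_def bij_betw_def)
  have uh: "u (h s) = s" "h s < n" if "s \<in> S" for s
    using h that by (auto simp: u_def bij_betw_def)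
  define G where "G i j = (\<Sum>m. u i m * u j m)" for i j
  have sums: "(\<lambda>m. u i m * u j m) sums G i j" if "i < n" "j < n" for i j
    unfolding G_def using u that by (intro summable_sums summable_mult_l2) auto
  have sym: "G i j = G j i" for i j
    by (simp add: G_def mult.commute)
  have psd: "0 \<le> (\<Sum>i<n. \<Sum>j<n. a i * a j * G i j)" for a
  proof -
    \<comment> \<open>The quadratic form of \<open>G\<close> is a series over \<open>m\<close> whose
      terms are squares.\<close>
    have "(\<lambda>m. \<Sum>i<n. \<Sum>j<n. a i * a j * (u i m * u j m)) sums (\<Sum>i<n. \<Sum>j<n. a i * a j * G i j)"
      by (intro sums_sum sums_mult sums) auto
    moreover have "(\<Sum>i<n. \<Sum>j<n. a i * a j * (u i m * u j m)) = (\<Sum>i<n. a i * u i m)\<^sup>2" for m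
      by (simp add: power2_eq_square sum_product ac_simps)
    ultimately show ?thesis
      using sums_le[OF _ sums_zero] by (smt (verit) zero_le_power2)
  qed
  obtain c where c: "\<And>i j. i < n \<Longrightarrow> j < n \<Longrightarrow> G i j = (\<Sum>k<n. c i k * c j k)"
    using cholesky_decomposition[OF sym psd] by blast
  define c' where "c' s = c (h s)" for s
  have "l2_dist s t = sqrt (\<Sum>k<n. (c' s k - c' t k)\<^sup>2)" if "s \<in> S" "t \<in> S" for s t
  proof -
    define i j where "i = h s" and "j = h t"
    have ij: "i < n" "j < n" "u i = s" "u j = t"
      using uh that by (auto simp: i_def j_def)
    have "(\<lambda>m. s m * s m - 2 * (s m * t m) + t m * t m) sums (G i i - 2 * G i j + G j j)"
      using sums[of i i] sums[of i j] sums[of j j] ij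
      by (intro sums_add sums_diff sums_mult) auto
    then have "(\<lambda>m. (s m - t m)\<^sup>2) sums (G i i - 2 * G i j + G j j)"
      by (simp add: power2_eq_square algebra_simps)
    moreover have "G i i - 2 * G i j + G j j = (\<Sum>k<n. (c i k - c j k)\<^sup>2)"
    proof -
      have "(c i k - c j k)\<^sup>2 = c i k * c i k - 2 * (c i k * c j k) + c j k * c j k" for k
        by (simp add: power2_eq_square algebra_simps)
      then show ?thesis
        using ij by (simp add: c sum.distrib sum_subtractf sum_distrib_left)
    qed
    ultimately show ?thesis
      by (simp add: l2_dist_def l2_norm_def c'_def i_def j_def sums_iff)
  qed
  then show ?thesis
    by blast
qed

section \<open>Embedding into \<open>\<ell>\<^sub>p\<^sup>m\<close>\<close>

text \<open>The coordinates of a point are its distances to all points of \<open>S\<close>. The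
  triangle inequality bounds every coordinate difference by \<open>d s t\<close>, and the coordinate
  belonging to \<open>t\<close> attains it.\<close>

lemma frechet_embedding:
  assumes "finite S"
    and refl: "\<And>s. s \<in> S \<Longrightarrow> d s s = 0"
    and sym: "\<And>s t. s \<in> S \<Longrightarrow> t \<in> S \<Longrightarrow> d s t = d t s"
    and tri: "\<And>s t u. s \<in> S \<Longrightarrow> t \<in> S \<Longrightarrow> u \<in> S \<Longrightarrow> d s u \<le> d s t + d t u"
  shows "\<exists>m y. \<forall>s\<in>S. \<forall>t\<in>S. lp_dist \<infinity> m (y s) (y t) = d s t"
proof -
  obtain h where h: "bij_betw h S {0..<card S}"
    using ex_bij_betw_finite_nat[OF assms(1)] by blast
  define u where "u = inv_into S h"
  have u: "u i \<in> S" if "i < card S" for i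
    using bij_betw_inv_into[OF h] that by (auto simp: u_def bij_betw_def)
  have uh: "u (h s) = s" "h s < card S" if "s \<in> S" for s
    using h that by (auto simp: u_def bij_betw_def)
  define y where "y s i = d s (u i)" for s i
  have "lp_dist \<infinity> (card S) (y s) (y t) = d s t" if st: "s \<in> S" "t \<in> S" for s t
  proof -
    have bound: "\<bar>d s v - d t v\<bar> \<le> d s t" if "v \<in> S" for v
      using tri[of s t v] tri[of t s v] sym[of s t] that st by (simp add: abs_le_iff)
    have "d s t = \<bar>d s (u (h t)) - d t (u (h t))\<bar>"
      using bound[of s] st by (simp add: uh refl)
    then have "d s t \<in> (\<lambda>i. \<bar>d s (u i) - d t (u i)\<bar>) ` {..<card S}"
      using uh[OF st(2)] by blast
    \<comment> \<open>Covers the \<open>0\<close> inserted under \<open>Max\<close> in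
      \<open>lp_norm\<close>.\<close>
    moreover have "0 \<le> d s t"
      using bound[of s] st by linarith
    ultimately show ?thesis
      unfolding lp_dist_def lp_norm_def y_def using bound u by (auto intro!: Max_eqI)
  qed
  then show ?thesis
    by blast
qed

section \<open>The cone of p-th powers of distances\<close>

text \<open>The dimension \<open>m\<close> is left free so that sums stay inside. Kernels take pairs
  so that they are vectors of real coordinates, as in
  \<open>cone_meets_kernel_of_mean_zero\<close>.\<close>

definition lp_kernels :: "real \<Rightarrow> ('b \<times> 'b \<Rightarrow> real) set" where
  "lp_kernels p = {\<lambda>(s, t). \<Sum>q<m. \<bar>y s q - y t q\<bar> powr p | (m::nat) y. True}"

text \<open>Concatenate the coordinates of the two maps.\<close>

lemma lp_kernels_add:
  assumes "D \<in> lp_kernels p" "E \<in> lp_kernels p"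
  shows "(\<lambda>i. D i + E i) \<in> lp_kernels p"
proof -
  obtain m :: nat and y where D: "D = (\<lambda>(s, t). \<Sum>q<m. \<bar>y s q - y t q\<bar> powr p)"
    using assms(1) by (auto simp: lp_kernels_def)
  obtain l :: nat and z where E: "E = (\<lambda>(s, t). \<Sum>q<l. \<bar>z s q - z t q\<bar> powr p)"
    using assms(2) by (auto simp: lp_kernels_def)
  define w where "w s q = (if q < m then y s q else z s (q - m))" for s q
  have "(\<Sum>q<m+l. \<bar>w s q - w t q\<bar> powr p)
      = (\<Sum>q<m. \<bar>y s q - y t q\<bar> powr p) + (\<Sum>q<l. \<bar>z s q - z t q\<bar> powr p)" for s t
  proof -
    have "(\<Sum>q<m+l. f q) = (\<Sum>q<m. f q) + (\<Sum>q<l. f (m + q))" for f :: "nat \<Rightarrow> real"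
      by (induction l) auto
    then show ?thesis by (simp add: w_def)
  qed
  then show ?thesis
    unfolding lp_kernels_def D E by (auto intro!: exI[of _ "m+l"] exI[of _ w])
qed

text \<open>Multiplying all points by \<open>c powr (1 / p)\<close> multiplies p-th powers of
  differences by \<open>c\<close>.\<close>

lemma lp_kernels_scale:
  assumes "0 < p" "0 < c" "D \<in> lp_kernels p"
  shows "(\<lambda>i. c * D i) \<in> lp_kernels p"
proof -
  obtain m :: nat and y where D: "D = (\<lambda>(s, t). \<Sum>q<m. \<bar>y s q - y t q\<bar> powr p)"
    using assms(3) by (auto simp: lp_kernels_def)
  define b where "b = c powr (1 / p)"
  have b: "0 < b" "b powr p = c"
    using assms by (auto simp: b_def powr_powr)
  have "\<bar>b * y s q - b * y t q\<bar> powr p = c * \<bar>y s q - y t q\<bar> powr p" for s t q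
  proof -
    have "\<bar>b * y s q - b * y t q\<bar> = b * \<bar>y s q - y t q\<bar>"
      using b by (simp add: abs_mult right_diff_distrib[symmetric])
    then show ?thesis
      using b by (simp add: powr_mult)
  qed
  then show ?thesis
    unfolding lp_kernels_def D
    by (auto simp: sum_distrib_left intro!: exI[of _ m] exI[of _ "\<lambda>s q. b * y s q"])
qed

text \<open>For Gaussian \<open>x\<close> the random kernel \<open>F x\<close> has mean
  \<open>z\<close>, so \<open>F x - z\<close> has mean zero and takes values in the cone
  \<open>K\<close>. A point of \<open>K\<close> vanishing on \<open>S \<times> S\<close> is a kernel
  equal there to a positive multiple of \<open>z\<close>.\<close>

lemma euclidean_lp_kernel:
  fixes c :: "'b \<Rightarrow> nat \<Rightarrow> real"
  assumes "finite S" "0 < p"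
  shows "\<exists>D\<in>lp_kernels p. \<forall>s\<in>S. \<forall>t\<in>S. D (s, t) = sqrt (\<Sum>k<n. (c s k - c t k)\<^sup>2) powr p"
proof -
  define z :: "'b \<times> 'b \<Rightarrow> real"
    where "z = (\<lambda>(s, t). normal_abs_moment p * sqrt (\<Sum>k<n. (c s k - c t k)\<^sup>2) powr p)"
  \<comment> \<open>Requiring \<open>0 < w\<close> keeps track of the total weight of the combination.\<close>
  define K where "K = {\<lambda>i. D i - w * z i | D w. D \<in> lp_kernels p \<and> 0 < w}"
  define F :: "(nat \<Rightarrow> real) \<Rightarrow> 'b \<times> 'b \<Rightarrow> real"
    where "F = (\<lambda>x (s, t). \<bar>\<Sum>k<n. (c s k - c t k) * x k\<bar> powr p)"
  define H where "H = (\<lambda>x i. F x i - z i)"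
  define R where "R = restrict_space (PiM (UNIV :: ('b \<times> 'b) set) (\<lambda>_. borel :: real measure)) K"
  interpret prob_space "iid_normal n" by (rule prob_space_iid_normal)
  have Fmeas [measurable]: "(\<lambda>x. F x i) \<in> borel_measurable (iid_normal n)" for i
    unfolding F_def by (cases i) (simp, measurable)
  have intF: "integrable (iid_normal n) (\<lambda>x. F x i)" "(\<integral>x. F x i \<partial>iid_normal n) = z i" for i
    using integrable_iid_normal_powr[OF assms(2)] integral_iid_normal_powr[OF assms(2)]
    by (cases i; simp add: F_def z_def)+
  have F_in: "F x \<in> lp_kernels p" for x
  proof -
    \<comment> \<open>A kernel with one coordinate: \<open>s\<close> is sent to the inner product of
      \<open>c s\<close> with \<open>x\<close>.\<close>
    have "F x = (\<lambda>(s, t). \<Sum>q<1::nat. \<bar>(\<Sum>k<n. c s k * x k) - (\<Sum>k<n. c t k * x k)\<bar> powr p)"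
      by (auto simp: F_def left_diff_distrib sum_subtractf)
    then show ?thesis
      unfolding lp_kernels_def by (auto intro!: exI[of _ 1] exI[of _ "\<lambda>s _. \<Sum>k<n. c s k * x k"])
  qed
  have HK: "H x \<in> K" for x
    unfolding K_def H_def using F_in[of x] by (auto intro!: exI[of _ "F x"] exI[of _ 1])
  have Hmeas [measurable]: "H \<in> measurable (iid_normal n) R"
    unfolding R_def
  proof (rule measurable_restrict_space2)
    show "H \<in> measurable (iid_normal n) (PiM UNIV (\<lambda>_. borel))"
    proof (rule measurable_PiM_single')
      show "(\<lambda>x. H x i) \<in> borel_measurable (iid_normal n)" for i
        unfolding H_def by measurable
    qed auto
  qed (use HK in auto)
  have Rmeas [measurable]: "(\<lambda>x. x i) \<in> borel_measurable R" for i
    unfolding R_def by (rule measurable_restrict_space1) (rule measurable_component_singleton, simp)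
  have "\<exists>k\<in>K. \<forall>i\<in>S \<times> S. k i = 0"
  proof (rule cone_meets_kernel_of_mean_zero[where N = "distr (iid_normal n) R H"])
    show "finite (S \<times> S)" using assms(1) by simp
    show "(\<lambda>i. f i + g i) \<in> K" if fg: "f \<in> K" "g \<in> K" for f g
    proof -
      obtain D v E w where "D \<in> lp_kernels p" "0 < v" "f = (\<lambda>i. D i - v * z i)"
        "E \<in> lp_kernels p" "0 < w" "g = (\<lambda>i. E i - w * z i)"
        using fg unfolding K_def by blast
      then show ?thesis
        unfolding K_def using lp_kernels_add[of D p E]
        by (auto intro!: exI[of _ "\<lambda>i. D i + E i"] exI[of _ "v + w"] simp: algebra_simps)
    qed
    show "(\<lambda>i. a * f i) \<in> K" if f: "f \<in> K" and a: "0 < a" for a f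
    proof -
      obtain D v where "D \<in> lp_kernels p" "0 < v" "f = (\<lambda>i. D i - v * z i)"
        using f unfolding K_def by blast
      then show ?thesis
        unfolding K_def using lp_kernels_scale[OF assms(2) a, of D] a
        by (auto intro!: exI[of _ "\<lambda>i. a * D i"] exI[of _ "a * v"] simp: algebra_simps)
    qed
    show "finite_measure (distr (iid_normal n) R H)"
      by (rule finite_measure_distr) measurable
    have "prob_space (distr (iid_normal n) R H)"
      by (rule prob_space_distr) measurable
    then show "emeasure (distr (iid_normal n) R H) (space (distr (iid_normal n) R H)) \<noteq> 0"
      using prob_space.emeasure_space_1 by fastforce
    show "space (distr (iid_normal n) R H) \<subseteq> K"
      by (auto simp: R_def space_restrict_space)
    show "(\<lambda>x. x i) \<in> borel_measurable (distr (iid_normal n) R H)" for i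
      by simp
    show "integrable (distr (iid_normal n) R H) (\<lambda>x. x i)" for i
      using intF[of i] by (subst integrable_distr_eq) (simp_all add: H_def[symmetric], simp add: H_def)
    have "(\<integral>x. x i \<partial>distr (iid_normal n) R H) = (\<integral>x. H x i \<partial>iid_normal n)" for i
      by (rule integral_distr) measurable
    then show "(\<integral>x. x i \<partial>distr (iid_normal n) R H) = 0" for i
      using intF[of i] by (simp add: H_def prob_space)
  qed
  then obtain D w where D: "D \<in> lp_kernels p" "0 < w" "\<And>i. i \<in> S \<times> S \<Longrightarrow> D i = w * z i"
    by (auto simp: K_def)
  \<comment> \<open>Cancels both the weight \<open>w\<close> and the moment contained in
    \<open>z\<close>.\<close>
  define a where "a = 1 / (w * normal_abs_moment p)"
  have m: "0 < normal_abs_moment p"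
    using assms(2) by (intro normal_abs_moment_pos) simp
  then have "0 < a"
    using D(2) by (simp add: a_def)
  from lp_kernels_scale[OF assms(2) this D(1)] show ?thesis
    by (rule bexI[rotated]) (use D m in \<open>auto simp: a_def z_def\<close>)
qed

lemma finite_l2_in_lp:
  assumes "finite S" "S \<subseteq> l2" "1 \<le> p"
  shows "\<exists>m y. \<forall>s\<in>S. \<forall>t\<in>S. lp_dist p m (y s) (y t) = l2_dist s t"
proof -
  obtain n :: nat and c where c: "\<And>s t. s \<in> S \<Longrightarrow> t \<in> S \<Longrightarrow> l2_dist s t = sqrt (\<Sum>k<n. (c s k - c t k)\<^sup>2)"
    using finite_l2_euclidean[OF assms(1,2)] by blast
  show ?thesis
  proof (cases p)
    case (real r)
    with assms(3) have r: "0 < r" by simp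
    obtain D where D: "D \<in> lp_kernels r"
      "\<And>s t. s \<in> S \<Longrightarrow> t \<in> S \<Longrightarrow> D (s, t) = sqrt (\<Sum>k<n. (c s k - c t k)\<^sup>2) powr r"
      using euclidean_lp_kernel[OF assms(1) r, where c = c and n = n] by blast
    then obtain m :: nat and y where y: "D = (\<lambda>(s, t). \<Sum>q<m. \<bar>y s q - y t q\<bar> powr r)"
      by (auto simp: lp_kernels_def)
    have "lp_dist p m (y s) (y t) = l2_dist s t" if "s \<in> S" "t \<in> S" for s t
    proof -
      have "(\<Sum>q<m. \<bar>y s q - y t q\<bar> powr r) = l2_dist s t powr r"
        using D(2)[OF that] c[OF that] y by simp
      \<comment> \<open>Nonnegativity lets the exponent \<open>1 / r\<close> undo
        \<open>powr r\<close>.\<close>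
      moreover have "0 \<le> l2_dist s t"
        using c[OF that] by (simp add: sum_nonneg)
      ultimately show ?thesis
        using r by (simp add: lp_dist_def lp_norm_def real powr_powr)
    qed
    then show ?thesis by blast
  next
    case PInf
    \<comment> \<open>In Euclidean coordinates the triangle inequality is Minkowski's for finite
      sums.\<close>
    have L2: "l2_dist s t = L2_set (\<lambda>k. c s k - c t k) {..<n}" if "s \<in> S" "t \<in> S" for s t
      using c[OF that] by (simp add: L2_set_def)
    show ?thesis
      unfolding PInf
    proof (rule frechet_embedding[OF assms(1)])
      fix s t u assume S: "s \<in> S" "t \<in> S" "u \<in> S"
      show "l2_dist s s = 0" "l2_dist s t = l2_dist t s"
        using S by (simp_all add: c power2_commute)
      show "l2_dist s u \<le> l2_dist s t + l2_dist t u"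
        using L2_set_triangle_ineq[of "\<lambda>k. c s k - c t k" "\<lambda>k. c t k - c u k" "{..<n}"] S
        by (simp add: L2)
    qed
  qed (use assms(3) in simp)
qed

theorem theorem4p5:
  assumes "infinite_dimensional TYPE('a::banach)"
    and "\<exists>p::ereal. 1 \<le> p \<and>
           (\<forall>m. embeds_isometrically (real_vectors m) (lp_dist p m) TYPE('a))"
  shows "\<forall>S. finite S \<and> S \<subseteq> l2 \<longrightarrow> embeds_isometrically S l2_dist TYPE('a)"
proof (intro allI impI)
  fix S assume S: "finite S \<and> S \<subseteq> l2"
  obtain p :: ereal where p: "1 \<le> p"
    and emb: "\<And>m. embeds_isometrically (real_vectors m) (lp_dist p m) TYPE('a)"
    using assms(2) by blast
  from S p have "\<exists>m y. \<forall>s\<in>S. \<forall>t\<in>S. lp_dist p m (y s) (y t) = l2_dist s t"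
    by (intro finite_l2_in_lp) auto
  then obtain m y where y: "\<And>s t. s \<in> S \<Longrightarrow> t \<in> S \<Longrightarrow> lp_dist p m (y s) (y t) = l2_dist s t"
    by blast
  obtain f :: "(nat \<Rightarrow> real) \<Rightarrow> 'a" where f: "isometric_embedding (real_vectors m) (lp_dist p m) f"
    using emb by (auto simp: embeds_isometrically_def)
  \<comment> \<open>Members of \<open>real_vectors m\<close> are \<open>undefined\<close> outside
    \<open>{..<m}\<close>; \<open>lp_dist p m\<close> reads only the coordinates below
    \<open>m\<close>, so truncation keeps distances.\<close>
  define r where "r s = restrict (y s) {..<m}" for s
  have r: "r s \<in> real_vectors m" for s
    by (simp add: r_def real_vectors_def)
  have "lp_dist p m (r s) (r t) = lp_dist p m (y s) (y t)" for s t
    by (simp add: lp_dist_def lp_norm_def r_def cong: image_cong_simp)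
  then have "isometric_embedding S l2_dist (\<lambda>s. f (r s))"
    using f r y by (simp add: isometric_embedding_def)
  then show "embeds_isometrically S l2_dist TYPE('a)"
    unfolding embeds_isometrically_def by blast
qed

end
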